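(* Let $n\ge 1$, $k\ge 2$ and $p\ge 1$ be integers with $p\le k(n-1)+1$. Suppose there are $k$ cakes and $p$ hungry players, each of whom finds at least one $k$-piece selection acceptable in every division of the $k$ cakes into $n$ pieces each, and suppose all player preference sets are closed. Then there exist a division $x$ of the $k$ cakes into $n$ pieces each, a set $N$ of at least $\left\lceil\frac{p}{2k(k-1)}\right\rceil$ players, and for each player $i\in N$ a $k$-piece selection acceptable to player $i$ in the division $x$, such that these selections are pairwise disjoint. Moreover, if $p$ divides $k(n-1)+1$, then there exist such a division and such a set $N$ of at least $\left\lceil\frac{p}{k(k-1)}\right\rceil$ players.
   Context: $[n]=\{1,\dots,n\}$ and $\Delta_{n-1}=\{y\in\mathbb{R}^n_{\ge 0}:\sum_{i} y_i=1\}$. A division of the $k$ cakes into $n$ pieces each is a point $x=(x_1,\dots,x_k)\in P(n,k)=(\Delta_{n-1})^k$, where the $i$-th coordinate of $x_j\in\Delta_{n-1}$ is the width of the $i$-th piece of the $j$-th cake; a piece is empty if its width is $0$. A $k$-piece selection is a choice of one piece in each cake, i.e. a tuple $s=(s_1,\dots,s_k)\in[n]^k$. Two selections $s,t$ are disjoint if they share no piece, i.e. $s_j\ne t_j$ for every $j\in[k]$. Each player $i$ has preferences given by a set $C^i_s\subseteq P(n,k)$ for each $s\in[n]^k$: $s$ is acceptable to (preferred by) player $i$ in the division $x$ iff $x\in C^i_s$; several selections may be acceptable in the same division. Closed preference sets means that every $C^i_s$ is closed. A player is hungry if the player never prefers an empty piece to a non-empty piece: any selection acceptable in a division consists only of non-empty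 pieces (every cake has at least one non-empty piece). *)

theory Defs
  imports "HOL-Analysis.Analysis"
begin

text \<open>
  The \<open>k\<close> cakes are indexed by a finite type \<open>'k\<close> and the \<open>n\<close> pieces of each cake by a
  finite type \<open>'n\<close>, so \<open>k = CARD('k)\<close>, \<open>n = CARD('n)\<close>, and the space
  \<open>(\<real>\<^sup>n)\<^sup>k\<close> containing the divisions is \<open>real ^ 'n ^ 'k\<close>:
  \<open>x $ j $ i\<close> is the width of piece \<open>i\<close> of cake \<open>j\<close>.
\<close>

definition unit_simplex :: "(real ^ 'n) set" where
  "unit_simplex = {y. (\<forall>i. 0 \<le> y $ i) \<and> (\<Sum>i\<in>UNIV. y $ i) = 1}"

definition divisions :: "(real ^ 'n ^ 'k) set" where
  "divisions = {x. \<forall>j. x $ j \<in> unit_simplex}"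

definition empty_piece :: "real ^ 'n ^ 'k \<Rightarrow> 'k \<Rightarrow> 'n \<Rightarrow> bool" where
  "empty_piece x j i \<longleftrightarrow> x $ j $ i = 0"

type_synonym ('n, 'k) selection = "'k \<Rightarrow> 'n"

definition disjoint_selections :: "('n, 'k) selection \<Rightarrow> ('n, 'k) selection \<Rightarrow> bool" where
  "disjoint_selections s t \<longleftrightarrow> (\<forall>j. s j \<noteq> t j)"

text \<open>
  The preferences of one player: \<open>C s\<close> is the set of divisions in which the selection
  \<open>s\<close> is acceptable to the player.
\<close>

type_synonym ('n, 'k) preferences = "('n, 'k) selection \<Rightarrow> (real ^ 'n ^ 'k) set"

definition preference_sets :: "('n::finite, 'k::finite) preferences \<Rightarrow> bool" where
  "preference_sets C \<longleftrightarrow> (\<forall>s. C s \<subseteq> divisions)"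

text \<open>Closedness in the ambient space is closedness in \<open>divisions\<close>, which is itself closed.\<close>

definition closed_preferences :: "('n::finite, 'k::finite) preferences \<Rightarrow> bool" where
  "closed_preferences C \<longleftrightarrow> (\<forall>s. closed (C s))"

definition hungry :: "('n::finite, 'k::finite) preferences \<Rightarrow> bool" where
  "hungry C \<longleftrightarrow> (\<forall>x\<in>divisions. \<forall>s. x \<in> C s \<longrightarrow> (\<forall>j. \<not> empty_piece x j (s j)))"

definition always_accepts :: "('n::finite, 'k::finite) preferences \<Rightarrow> bool" where
  "always_accepts C \<longleftrightarrow> (\<forall>x\<in>divisions. \<exists>s. x \<in> C s)"

definition jointly_satisfied ::
  "('p \<Rightarrow> ('n::finite, 'k::finite) preferences) \<Rightarrow> real ^ 'n ^ 'k \<Rightarrow> 'p set \<Rightarrow> bool" where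
  "jointly_satisfied C x N \<longleftrightarrow>
    (\<exists>\<sigma>. (\<forall>i\<in>N. x \<in> C i (\<sigma> i)) \<and>
         pairwise (\<lambda>i i'. disjoint_selections (\<sigma> i) (\<sigma> i')) N)"

end

theory Submission
  imports Defs
begin

text \<open>
  Write \<open>n\<close> for the number of pieces, \<open>k\<close> for the number of cakes and \<open>D = k (n - 1) + 1\<close>, one
  more than the dimension of the space of divisions. The proof joins a topological theorem with a
  combinatorial one.

  The topological part treats \<open>D\<close> colours as players, each colour being a copy of one of the given
  players. It finds a division \<open>x\<close> and at most one selection per colour, acceptable in \<open>x\<close> to the
  player of that colour, such that suitable nonnegative weights on these selections give every piece
  of every cake the same total weight \<open>1/n\<close> (\<open>balanced_rainbow_exists\<close>). The space of divisions is
  covered by small sets with \<open>D\<close> colours such that no point lies in two distinct sets of the same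
  colour; the cover consists of the open vertex stars in the barycentric subdivision of a cubical
  grid, a vertex being coloured by the codimension of the grid face of which it is the centre
  (\<open>coloured_cover\<close>). Each set is labelled by a selection that the player of its colour accepts
  nearby. A partition of unity turns the labels into a continuous map \<open>F\<close> of the space of divisions
  into itself. Hunger makes \<open>F\<close> preserve faces, so \<open>F\<close> takes the barycentre as a value, by Brouwer's
  theorem (\<open>face_preserving_hits_barycentre\<close>); this yields the weights. Refining the cover and
  passing to the limit uses that the preference sets are closed.

  For the combinatorial part, a selection is an edge of a \<open>k\<close>-partite hypergraph whose vertices are
  the pieces. Multiplied by \<open>n\<close>, the weights form a fractional matching of total weight \<open>n\<close>. By a
  theorem of Fueredi a fractional matching of total weight \<open>t\<close> in a \<open>k\<close>-partite hypergraph
  has pairwise disjoint edges, at least \<open>t / (k - 1)\<close> of them, in its support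
  (\<open>fractional_matching_imp_matching\<close>). So there are at least \<open>n / (k - 1)\<close> pairwise disjoint
  selections of distinct colours.

  It remains to return from colours to players. Dealing the \<open>D\<close> colours to the \<open>p\<close> players cyclically,
  every player gets at most \<open>q = \<lceil>D / p\<rceil>\<close> colours, so at least \<open>n / (q (k - 1))\<close> distinct players
  are served. Now \<open>D \<le> k n\<close>, while \<open>p q \<le> 2 D\<close> in general and \<open>p q = D\<close> if \<open>p\<close> divides \<open>D\<close>;
  this gives the two bounds.
\<close>

section \<open>Matchings from fractional matchings\<close>

text \<open>
  Gaussian elimination, by induction on the number of equations: one equation with a nonzero
  coefficient is solved for the corresponding unknown and substituted into the others.
\<close>

lemma homogeneous_system_nontrivial_solution:
  fixes a :: "'r \<Rightarrow> 'c \<Rightarrow> real"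
  assumes "finite R" "finite B" "card R < card B"
  shows "\<exists>u. (\<exists>b\<in>B. u b \<noteq> 0) \<and> (\<forall>b. b \<notin> B \<longrightarrow> u b = 0) \<and> (\<forall>r\<in>R. (\<Sum>b\<in>B. a r b * u b) = 0)"
  using assms
proof (induction R arbitrary: B a rule: finite_induct)
  case empty
  then obtain b0 where "b0 \<in> B" by fastforce
  then show ?case by (intro exI[of _ "\<lambda>b. if b = b0 then 1 else 0"]) auto
next
  case (insert r0 R)
  show ?case
  proof (cases "\<forall>b\<in>B. a r0 b = 0")
    case True
    have "card R < card B" using insert by simp
    from insert.IH[OF insert.prems(1) this, of a] obtain u where u: "\<exists>b\<in>B. u b \<noteq> 0"
      "\<forall>b. b \<notin> B \<longrightarrow> u b = 0" "\<forall>r\<in>R. (\<Sum>b\<in>B. a r b * u b) = 0" by blast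
    moreover have "(\<Sum>b\<in>B. a r0 b * u b) = 0" using True by simp
    ultimately show ?thesis by blast
  next
    case False
    then obtain b0 where b0: "b0 \<in> B" "a r0 b0 \<noteq> 0" by auto
    define B' where "B' = B - {b0}"
    define a' where "a' r b = a r b - a r b0 * a r0 b / a r0 b0" for r b
    have "finite B'" "card R < card B'" using insert b0 by (auto simp: B'_def)
    from insert.IH[OF this, of a'] obtain v where v: "\<exists>b\<in>B'. v b \<noteq> 0" "\<And>b. b \<notin> B' \<Longrightarrow> v b = 0"
        "\<And>r. r \<in> R \<Longrightarrow> (\<Sum>b\<in>B'. a' r b * v b) = 0" by blast
    define t where "t = - (\<Sum>b\<in>B'. a r0 b * v b) / a r0 b0"
    define u where "u = v(b0 := t)"
    have split: "(\<Sum>b\<in>B. a r b * u b) = a r b0 * t + (\<Sum>b\<in>B'. a r b * v b)" for r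
    proof -
      have "(\<Sum>b\<in>B. a r b * u b) = a r b0 * u b0 + (\<Sum>b\<in>B'. a r b * u b)"
        unfolding B'_def using b0 insert.prems by (intro sum.remove) auto
      also have "(\<Sum>b\<in>B'. a r b * u b) = (\<Sum>b\<in>B'. a r b * v b)"
        by (rule sum.cong) (auto simp: u_def B'_def)
      finally show ?thesis by (simp add: u_def)
    qed
    have "(\<Sum>b\<in>B. a r b * u b) = 0" if "r \<in> insert r0 R" for r
    proof (cases "r = r0")
      case True
      then show ?thesis using b0 unfolding split t_def by simp
    next
      case False
      with that have "0 = (\<Sum>b\<in>B'. a' r b * v b)" using v(3) by auto
      also have "\<dots> = (\<Sum>b\<in>B'. a r b * v b - a r b0 / a r0 b0 * (a r0 b * v b))"
        by (rule sum.cong) (auto simp: a'_def algebra_simps)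
      also have "\<dots> = (\<Sum>b\<in>B'. a r b * v b) + a r b0 * t"
        unfolding sum_subtractf sum_distrib_left[symmetric] t_def by simp
      finally show ?thesis unfolding split by simp
    qed
    moreover have "\<exists>b\<in>B. u b \<noteq> 0" using v(1) by (auto simp: u_def B'_def)
    moreover have "\<forall>b. b \<notin> B \<longrightarrow> u b = 0" using v(2) b0 by (auto simp: u_def B'_def)
    ultimately show ?thesis by blast
  qed
qed

definition load :: "(('n::finite, 'k::finite) selection \<Rightarrow> real) \<Rightarrow> 'k \<Rightarrow> 'n \<Rightarrow> real" where
  "load w j i = (\<Sum>e | e j = i. w e)"

text \<open>
  All constraints on a fractional matching are collected in one finite family: \<open>Inl e\<close> stands for
  nonnegativity of the weight of \<open>e\<close>, and \<open>Inr (j, i)\<close> for the capacity 1 of the piece \<open>i\<close> of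
  cake \<open>j\<close>.
\<close>

fun slack :: "(('n::finite, 'k::finite) selection \<Rightarrow> real) \<Rightarrow> ('n, 'k) selection + 'k \<times> 'n \<Rightarrow> real" where
  "slack w (Inl e) = w e"
| "slack w (Inr (j, i)) = 1 - load w j i"

text \<open>
  The derivative of the slack along the direction \<open>u\<close>; see \<open>slack_move\<close>.
\<close>

fun slack_rate :: "(('n::finite, 'k::finite) selection \<Rightarrow> real) \<Rightarrow> ('n, 'k) selection + 'k \<times> 'n \<Rightarrow> real" where
  "slack_rate u (Inl e) = u e"
| "slack_rate u (Inr (j, i)) = - load u j i"

definition fractional_matching :: "(('n::finite, 'k::finite) selection \<Rightarrow> real) \<Rightarrow> bool" where
  "fractional_matching w \<longleftrightarrow> (\<forall>c. 0 \<le> slack w c)"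

text \<open>
  The vertices of the polytope of fractional matchings: no line through \<open>w\<close> keeps every tight
  constraint tight.
\<close>

definition basic :: "(('n::finite, 'k::finite) selection \<Rightarrow> real) \<Rightarrow> bool" where
  "basic w \<longleftrightarrow> (\<forall>u. (\<forall>c. slack w c = 0 \<longrightarrow> slack_rate u c = 0) \<longrightarrow> (\<forall>e. u e = 0))"

lemma fractional_matchingD:
  assumes "fractional_matching w"
  shows "0 \<le> w e" "load w j i \<le> 1"
  using assms unfolding fractional_matching_def
  by (metis slack.simps(1), metis slack.simps(2) diff_ge_0_iff_ge)

lemma fractional_matchingI:
  assumes "\<And>e. 0 \<le> w e" "\<And>j i. load w j i \<le> 1"
  shows "fractional_matching w"
proof -
  have "0 \<le> slack w c" for c
    by (cases "(w, c)" rule: slack.cases) (use assms in auto)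
  then show ?thesis by (simp add: fractional_matching_def)
qed

lemma load_add: "load (\<lambda>e. w e + l * u e) j i = load w j i + l * load u j i"
  by (simp add: load_def sum.distrib sum_distrib_left)

lemma slack_move: "slack (\<lambda>e. w e + l * u e) c = slack w c + l * slack_rate u c"
  by (cases "(w, c)" rule: slack.cases) (simp_all add: load_add)

lemma slack_rate_minus: "slack_rate (\<lambda>e. - u e) c = - slack_rate u c"
  by (cases "(u, c)" rule: slack.cases) (simp_all add: load_def sum_negf)

lemma sum_load: "(\<Sum>i\<in>UNIV. load w j i) = (\<Sum>e\<in>UNIV. w e)"
  unfolding load_def using sum.group[of "UNIV::('a::finite,'b::finite) selection set" UNIV "\<lambda>e. e j" w] by simp

text \<open>
  If \<open>w\<close> is not a vertex, it can be moved along a line that keeps the tight constraints tight, in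
  the direction in which the total weight does not decrease, until a further constraint becomes
  tight. The motion stops because along any nonzero direction some slack decreases: either some
  weight falls, or no weight falls and some weight grows, and then a load grows with it.
\<close>

lemma improve_non_basic:
  fixes w :: "('n::finite, 'k::finite) selection \<Rightarrow> real"
  assumes w: "fractional_matching w" and nb: "\<not> basic w"
  shows "\<exists>w'. fractional_matching w' \<and> sum w UNIV \<le> sum w' UNIV \<and>
           {c. 0 < slack w' c} \<subset> {c. 0 < slack w c}"
proof -
  obtain u0 where u0: "\<And>c. slack w c = 0 \<Longrightarrow> slack_rate u0 c = 0" "\<exists>e. u0 e \<noteq> 0"
    using nb unfolding basic_def by blast
  obtain u where u: "\<And>c. slack w c = 0 \<Longrightarrow> slack_rate u c = 0" "\<exists>e. u e \<noteq> 0" "0 \<le> sum u UNIV"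
  proof (cases "0 \<le> sum u0 UNIV")
    case True then show ?thesis using that u0 by blast
  next
    case False
    then show ?thesis using that[of "\<lambda>e. - u0 e"] u0 by (auto simp: slack_rate_minus sum_negf)
  qed
  have "\<exists>c. slack_rate u c < 0"
  proof (cases "\<exists>e. u e < 0")
    case True then show ?thesis by (metis slack_rate.simps(1))
  next
    case False
    then obtain e where e: "0 < u e" using u(2) by (metis linorder_neqE_linordered_idom)
    have "u e \<le> load u undefined (e undefined)" unfolding load_def
      using False by (intro member_le_sum) (auto simp: not_less)
    then have "slack_rate u (Inr (undefined, e undefined)) < 0" using e by simp
    then show ?thesis by blast
  qed
  \<comment> \<open>the first time at which some constraint that is still slack becomes an equality\<close>
  define K where "K = {c. slack_rate u c < 0}"
  define f where "f c = slack w c / - slack_rate u c" for c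
  define l where "l = Min (f ` K)"
  have K: "finite K" "K \<noteq> {}" using \<open>\<exists>c. slack_rate u c < 0\<close> by (auto simp: K_def)
  have "l \<in> f ` K" unfolding l_def using K by (intro Min_in) auto
  then obtain c0 where c0: "c0 \<in> K" "l = f c0" by blast
  have w0: "0 \<le> slack w c" for c using w by (simp add: fractional_matching_def)
  \<comment> \<open>tight constraints do not move, so the moving ones are slack\<close>
  have pos: "0 < slack w c" if "slack_rate u c \<noteq> 0" for c using w0[of c] u(1)[of c] that by linarith
  have "0 \<le> l" using c0 w0[of c0] by (simp add: f_def K_def divide_nonneg_neg)
  define w' where "w' = (\<lambda>e. w e + l * u e)"
  have "0 \<le> slack w' c" for c
  proof (cases "c \<in> K")
    case True
    then have "l \<le> f c" using K by (simp add: l_def)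
    moreover have "0 < - slack_rate u c" using True by (simp add: K_def)
    ultimately have "l * (- slack_rate u c) \<le> slack w c" unfolding f_def
      by (subst (asm) pos_le_divide_eq)
    then show ?thesis by (simp add: w'_def slack_move)
  next
    case False
    then show ?thesis using \<open>0 \<le> l\<close> w0[of c] by (simp add: w'_def slack_move K_def)
  qed
  then have "fractional_matching w'" by (simp add: fractional_matching_def)
  moreover have "sum w UNIV \<le> sum w' UNIV"
    using u(3) \<open>0 \<le> l\<close> by (simp add: w'_def sum.distrib sum_distrib_left[symmetric])
  moreover have "{c. 0 < slack w' c} \<subseteq> {c. 0 < slack w c}"
  proof safe
    fix c assume "0 < slack w' c"
    then show "0 < slack w c"
      using pos[of c] by (cases "slack_rate u c = 0") (auto simp: w'_def slack_move)
  qed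
  moreover have "slack_rate u c0 < 0" "0 < slack w c0" using c0 pos[of c0] by (auto simp: K_def)
  moreover from this have "slack w' c0 = 0" 
    unfolding w'_def slack_move c0(2) f_def by simp
  moreover from calculation have "{c. 0 < slack w' c} \<noteq> {c. 0 < slack w c}"
    by (metis less_irrefl mem_Collect_eq)
  ultimately show ?thesis by blast
qed

lemma exists_basic_fractional_matching:
  fixes w :: "('n::finite, 'k::finite) selection \<Rightarrow> real"
  assumes "fractional_matching w"
  shows "\<exists>w'. fractional_matching w' \<and> basic w' \<and> sum w UNIV \<le> sum w' UNIV \<and>
           (\<forall>e. w e = 0 \<longrightarrow> w' e = 0)"
  using assms
proof (induction "card {c. 0 < slack w c}" arbitrary: w rule: less_induct)
  case less
  show ?case
  proof (cases "basic w")
    case True then show ?thesis using less.prems by blast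
  next
    case False
    from improve_non_basic[OF less.prems False] obtain w1 where w1: "fractional_matching w1"
      "sum w UNIV \<le> sum w1 UNIV" "{c. 0 < slack w1 c} \<subset> {c. 0 < slack w c}" by blast
    have "card {c. 0 < slack w1 c} < card {c. 0 < slack w c}"
      by (rule psubset_card_mono[OF _ w1(3)]) simp
    from less.hyps[OF this w1(1)] obtain w' where w': "fractional_matching w'" "basic w'"
      "sum w1 UNIV \<le> sum w' UNIV" "\<forall>e. w1 e = 0 \<longrightarrow> w' e = 0" by blast
    have "w1 e = 0" if "w e = 0" for e
    proof -
      have "Inl e \<notin> {c. 0 < slack w c}" using that by simp
      then have "Inl e \<notin> {c. 0 < slack w1 c}" using w1(3) by blast
      then show ?thesis using fractional_matchingD(1)[OF w1(1), of e] by simp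
    qed
    then show ?thesis using w' w1(2) by (meson order_trans)
  qed
qed

lemma load_supported:
  assumes "\<And>e. e \<notin> S \<Longrightarrow> u e = 0"
  shows "load u j i = (\<Sum>e\<in>S. (if e j = i then 1 else 0) * u e)"
proof -
  have "load u j i = (\<Sum>e\<in>UNIV. if e j = i then u e else 0)"
    unfolding load_def by (simp add: sum.If_cases)
  also have "\<dots> = (\<Sum>e\<in>S. if e j = i then u e else 0)"
    using assms by (intro sum.mono_neutral_right) auto
  also have "\<dots> = (\<Sum>e\<in>S. (if e j = i then 1 else 0) * u e)" by (rule sum.cong) auto
  finally show ?thesis .
qed

text \<open>
  At a vertex the tight capacities have full rank on the support: fewer equations than edges leave a
  nonzero solution \<open>u\<close>, and it must violate some tight capacity. Having \<open>R\<close> as a parameter allows a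
  single redundant capacity to be dropped later.
\<close>

lemma basic_tight_rank:
  fixes w :: "('n::finite, 'k::finite) selection \<Rightarrow> real"
    and R :: "('k \<times> 'n) set"
  assumes b: "basic w" and R: "card R < card {e. w e \<noteq> 0}"
  shows "\<exists>u. (\<forall>e. w e = 0 \<longrightarrow> u e = 0) \<and> (\<forall>(j,i)\<in>R. load u j i = 0) \<and>
             (\<exists>j i. load w j i = 1 \<and> load u j i \<noteq> 0)"
proof -
  let ?S = "{e. w e \<noteq> 0}"
  have "finite R" "finite ?S" by auto
  from homogeneous_system_nontrivial_solution[OF this R, of "\<lambda>r e. if e (fst r) = snd r then 1 else 0"]
  obtain u :: "('n, 'k) selection \<Rightarrow> real"
    where u: "\<exists>e\<in>?S. u e \<noteq> 0" "\<And>e. e \<notin> ?S \<Longrightarrow> u e = 0"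
    "\<And>r. r \<in> R \<Longrightarrow> (\<Sum>e\<in>?S. (if e (fst r) = snd r then 1 else 0) * u e) = 0"
    by blast
  have "load u j i = 0" if "(j,i) \<in> R" for j i
    using u(3)[OF that] by (subst load_supported[where S = ?S]) (use u(2) in auto)
  moreover have "\<exists>c. slack w c = 0 \<and> slack_rate u c \<noteq> 0"
    using b u(1) unfolding basic_def by blast
  then have "\<exists>j i. load w j i = 1 \<and> load u j i \<noteq> 0"
  proof
    fix c assume "slack w c = 0 \<and> slack_rate u c \<noteq> 0"
    then show ?thesis using u(2) by (cases "(w, c)" rule: slack.cases) auto
  qed
  ultimately show ?thesis using u(2) by (intro exI[of _ u]) auto
qed

text \<open>
  This is where \<open>k\<close>-partiteness enters. Suppose that all weights are below \<open>1 / (k - 1)\<close>. Then a tight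
  piece lies in at least \<open>k\<close> edges of the support \<open>S\<close>. As each edge has \<open>k\<close> pieces, double counting gives
  at most \<open>card S\<close> tight pieces, whereas the rank condition requires at least \<open>card S\<close>. Hence
  equality holds throughout, and every piece of every edge of \<open>S\<close> is tight. But then the capacities
  are linearly dependent, because the loads in each cake add up to the total weight, and so one of
  them can be dropped, contradicting the rank condition.
\<close>

lemma basic_has_heavy_edge:
  fixes w :: "('n::finite, 'k::finite) selection \<Rightarrow> real"
  assumes k: "CARD('k) \<ge> 2" and b: "basic w" and ne: "\<exists>e. w e \<noteq> 0"
  shows "\<exists>e. 1 \<le> (real CARD('k) - 1) * w e"
proof (rule ccontr)
  assume "\<not> ?thesis"
  then have light: "(real CARD('k) - 1) * w e < 1" for e by (auto simp: not_le)
  define S where "S = {e. w e \<noteq> 0}"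
  define T where "T = {(j, i). load w j i = 1}"
  define deg where "deg v = card {e\<in>S. e (fst v) = snd v}" for v :: "'k \<times> 'n"
  have deg: "CARD('k) \<le> deg v" if "v \<in> T" for v
  proof -
    let ?N = "{e\<in>S. e (fst v) = snd v}"
    have one: "1 = (\<Sum>e\<in>?N. w e)"
    proof -
      have "1 = load w (fst v) (snd v)" using that by (auto simp: T_def)
      also have "\<dots> = (\<Sum>e\<in>?N. w e)" unfolding load_def
        by (rule sum.mono_neutral_right) (auto simp: S_def)
      finally show ?thesis .
    qed
    then have ne': "?N \<noteq> {}" by (metis sum.empty zero_neq_one)
    have "real CARD('k) - 1 = (\<Sum>e\<in>?N. (real CARD('k) - 1) * w e)"
      using one by (simp add: sum_distrib_left[symmetric])
    also have "\<dots> < (\<Sum>e\<in>?N. 1)" using ne' light by (intro sum_strict_mono) auto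
    also have "\<dots> = real (deg v)" by (simp add: deg_def)
    finally show ?thesis by linarith
  qed
  have cnt: "(\<Sum>v\<in>T. deg v) = (\<Sum>e\<in>S. card {j. (j, e j) \<in> T})"
  proof -
    have "(\<Sum>v\<in>T. deg v) = (\<Sum>v\<in>T. \<Sum>e\<in>S. if e (fst v) = snd v then 1 else 0)"
      by (simp add: deg_def sum.If_cases Int_def conj_commute)
    also have "\<dots> = (\<Sum>e\<in>S. \<Sum>v\<in>T. if e (fst v) = snd v then 1 else 0)" by (rule sum.swap)
    also have "\<dots> = (\<Sum>e\<in>S. card {v\<in>T. e (fst v) = snd v})"
      by (simp add: sum.If_cases Int_def)
    also have "\<dots> = (\<Sum>e\<in>S. card {j. (j, e j) \<in> T})"
    proof (rule sum.cong[OF refl])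
      fix e
      have "{v\<in>T. e (fst v) = snd v} = (\<lambda>j. (j, e j)) ` {j. (j, e j) \<in> T}" by force
      then show "card {v\<in>T. e (fst v) = snd v} = card {j. (j, e j) \<in> T}"
        by (simp add: card_image inj_on_def)
    qed
    finally show ?thesis .
  qed
  have le: "card {j. (j, e j) \<in> T} \<le> CARD('k)" for e by (rule card_mono) auto
  have "card T * CARD('k) \<le> (\<Sum>v\<in>T. deg v)"
    using sum_mono[of T "\<lambda>_. CARD('k)" deg] deg by simp
  then have low: "card T * CARD('k) \<le> (\<Sum>e\<in>S. card {j. (j, e j) \<in> T})" using cnt by simp
  also have "\<dots> \<le> card S * CARD('k)"
    using sum_mono[of S "\<lambda>e. card {j. (j, e j) \<in> T}" "\<lambda>_. CARD('k)"] le by simp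
  finally have "card T \<le> card S" by simp
  have "\<not> card T < card S"
  proof
    assume "card T < card S"
    from basic_tight_rank[OF b this[unfolded S_def]] show False by (auto simp: T_def)
  qed
  with \<open>card T \<le> card S\<close> have eq: "card T = card S" by simp
  have allT: "(j, e j) \<in> T" if "e \<in> S" for e j
  proof (rule ccontr)
    assume "(j, e j) \<notin> T"
    then have "card {j. (j, e j) \<in> T} < CARD('k)" by (intro psubset_card_mono) auto
    then have "(\<Sum>e\<in>S. card {j. (j, e j) \<in> T}) < (\<Sum>e\<in>S. CARD('k))"
      using that le by (intro sum_strict_mono_ex1) auto
    then show False using low eq by simp
  qed
  obtain e0 where e0: "e0 \<in> S" using ne by (auto simp: S_def)
  obtain j0 j1 :: 'k where j: "j0 \<noteq> j1"
    using k by (metis UNIV_I card_2_iff' ex_card)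
  let ?v0 = "(j0, e0 j0)"
  have "?v0 \<in> T" using allT e0 by blast
  then have "card (T - {?v0}) < card S" using eq by (metis card_Diff1_less finite)
  from basic_tight_rank[OF b this[unfolded S_def]] obtain u where
    u: "\<And>e. w e = 0 \<Longrightarrow> u e = 0" "\<And>j i. (j,i) \<in> T \<Longrightarrow> (j,i) \<noteq> ?v0 \<Longrightarrow> load u j i = 0"
       "\<exists>j i. load w j i = 1 \<and> load u j i \<noteq> 0" by blast
  have zero: "load u j i = 0" if "(j,i) \<noteq> ?v0" for j i
  proof (cases "(j,i) \<in> T")
    case True then show ?thesis using u(2) that by blast
  next
    case False
    have "u e = 0" if "e j = i" for e using allT[of e j] that False u(1)[of e] by (auto simp: S_def)
    then show ?thesis by (simp add: load_def)
  qed
  \<comment> \<open>the loads in cake \<open>j0\<close> and in cake \<open>j1\<close> have the same sum, which forces the last load to vanish\<close>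
  have "(\<Sum>i\<in>UNIV. load u j0 i) = (\<Sum>i\<in>UNIV. load u j1 i)" by (simp add: sum_load)
  also have "\<dots> = 0" using zero j by simp
  also have "(\<Sum>i\<in>UNIV. load u j0 i) = (\<Sum>i\<in>{e0 j0}. load u j0 i)"
    by (rule sum.mono_neutral_right) (use zero in auto)
  finally have "load u j0 (e0 j0) = 0" by simp
  then have "load u j i = 0" for j i using zero[of j i] by (cases "(j, i) = ?v0") auto
  then show False using u(3) by blast
qed

text \<open>
  Summing the loads of the \<open>k\<close> pieces of \<open>e\<close> gives at most \<open>k\<close>. This sum counts each edge meeting \<open>e\<close>
  at least once and \<open>e\<close> itself \<open>k\<close> times, that is \<open>k - 1\<close> times too often, and this surplus has weight
  at least 1.
\<close>

lemma heavy_edge_meets_little: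
  fixes w :: "('n::finite, 'k::finite) selection \<Rightarrow> real"
  assumes w: "fractional_matching w" and h: "1 \<le> (real CARD('k) - 1) * w e"
  shows "(\<Sum>f | \<not> disjoint_selections f e. w f) \<le> real CARD('k) - 1"
proof -
  let ?N = "{f. \<not> disjoint_selections f e}"
  have eN: "e \<in> ?N" by (simp add: disjoint_selections_def)
  have w0: "0 \<le> w f" for f using w by (rule fractional_matchingD)
  have "(\<Sum>f\<in>?N. w f) + (real CARD('k) - 1) * w e
      = real CARD('k) * w e + (\<Sum>f\<in>?N - {e}. w f)"
    using eN by (subst sum.remove[of _ e]) (auto simp: algebra_simps)
  also have "\<dots> \<le> real (card {j. e j = e j}) * w e + (\<Sum>f\<in>?N - {e}. real (card {j. f j = e j}) * w f)"
  proof (intro add_mono sum_mono)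
    fix f assume "f \<in> ?N - {e}"
    then have "{j. f j = e j} \<noteq> {}" by (auto simp: disjoint_selections_def)
    then have "1 \<le> real (card {j. f j = e j})" by (simp add: Suc_le_eq card_gt_0_iff)
    then show "w f \<le> real (card {j. f j = e j}) * w f" using w0[of f] by (simp add: mult_le_cancel_right1)
  qed simp
  also have "\<dots> = (\<Sum>f\<in>?N. real (card {j. f j = e j}) * w f)"
    using eN by (subst sum.remove[of ?N e]) auto
  also have "\<dots> \<le> (\<Sum>f\<in>UNIV. real (card {j. f j = e j}) * w f)"
    using w0 by (intro sum_mono2) auto
  also have "\<dots> = (\<Sum>f\<in>UNIV. \<Sum>j\<in>UNIV. if f j = e j then w f else 0)"
    by (simp add: sum.If_cases)
  also have "\<dots> = (\<Sum>j\<in>UNIV. \<Sum>f\<in>UNIV. if f j = e j then w f else 0)" by (rule sum.swap)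
  also have "\<dots> = (\<Sum>j\<in>UNIV. load w j (e j))"
    by (simp add: load_def sum.If_cases)
  also have "\<dots> \<le> (\<Sum>j\<in>(UNIV::'k set). 1)"
    using fractional_matchingD(2)[OF w] by (intro sum_mono) auto
  finally show ?thesis using h by simp
qed

text \<open>
  Fueredi's theorem for \<open>k\<close>-partite hypergraphs. Greedy choice: pass to a vertex of the polytope, put a
  heavy edge into the matching, discard the edges meeting it, which loses weight at most \<open>k - 1\<close>, and
  continue with the rest.
\<close>

theorem fractional_matching_imp_matching:
  fixes w :: "('n::finite, 'k::finite) selection \<Rightarrow> real"
  assumes k: "CARD('k) \<ge> 2" and w: "fractional_matching w"
  shows "\<exists>M\<subseteq>{e. w e \<noteq> 0}. pairwise disjoint_selections M \<and>
           sum w UNIV \<le> (real CARD('k) - 1) * real (card M)"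
  using w
proof (induction "card {e. w e \<noteq> 0}" arbitrary: w rule: less_induct)
  case less
  obtain w1 where w1: "fractional_matching w1" "basic w1" "sum w UNIV \<le> sum w1 UNIV"
    "\<And>e. w e = 0 \<Longrightarrow> w1 e = 0"
    using exists_basic_fractional_matching[OF less.prems] by blast
  show ?case
  proof (cases "\<exists>e. w1 e \<noteq> 0")
    case False
    then show ?thesis using w1(3) by (intro exI[of _ "{}"]) auto
  next
    case True
    obtain e where e: "1 \<le> (real CARD('k) - 1) * w1 e"
      using basic_has_heavy_edge[OF k w1(2) True] by blast
    let ?N = "{f. \<not> disjoint_selections f e}"
    define w2 where "w2 f = (if disjoint_selections f e then w1 f else 0)" for f
    have w10: "0 \<le> w1 f" for f using w1(1) by (rule fractional_matchingD)
    have fm2: "fractional_matching w2"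
    proof (rule fractional_matchingI)
      show "load w2 j i \<le> 1" for j i
      proof -
        have "load w2 j i \<le> load w1 j i" unfolding load_def
          by (intro sum_mono) (simp add: w2_def w10)
        then show ?thesis using fractional_matchingD(2)[OF w1(1), of j i] by linarith
      qed
    qed (simp add: w2_def w10)
    have "card {e. w2 e \<noteq> 0} < card {e. w e \<noteq> 0}"
    proof (intro psubset_card_mono psubsetI)
      show "{e. w2 e \<noteq> 0} \<subseteq> {e. w e \<noteq> 0}" using w1(4) by (auto simp: w2_def)
      have "w1 e \<noteq> 0" using e by auto
      then have "e \<in> {e. w e \<noteq> 0}" using w1(4) by blast
      moreover have "e \<notin> {e. w2 e \<noteq> 0}" by (simp add: w2_def disjoint_selections_def)
      ultimately show "{e. w2 e \<noteq> 0} \<noteq> {e. w e \<noteq> 0}" by blast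
    qed simp
    from less.hyps[OF this fm2] obtain M where M: "M \<subseteq> {e. w2 e \<noteq> 0}" "pairwise disjoint_selections M"
        "sum w2 UNIV \<le> (real CARD('k) - 1) * real (card M)"
      by blast
    have Me: "disjoint_selections f e" if "f \<in> M" for f
      using M(1) that unfolding w2_def by (auto split: if_splits)
    then have "e \<notin> M" by (auto simp: disjoint_selections_def)
    have "sum w1 UNIV = (\<Sum>f\<in>?N. w1 f) + sum w2 UNIV"
    proof -
      have "sum w1 UNIV = (\<Sum>f\<in>?N. w1 f) + (\<Sum>f\<in>-?N. w1 f)"
        using sum.subset_diff[of ?N UNIV w1] by (simp add: Compl_eq_Diff_UNIV add.commute)
      also have "(\<Sum>f\<in>-?N. w1 f) = sum w2 UNIV"
        by (rule sum.mono_neutral_cong_left) (auto simp: w2_def)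
      finally show ?thesis .
    qed
    also have "\<dots> \<le> (real CARD('k) - 1) * real (card (insert e M))"
      using heavy_edge_meets_little[OF w1(1) e] M(3) \<open>e \<notin> M\<close> by (simp add: algebra_simps)
    finally have "sum w UNIV \<le> (real CARD('k) - 1) * real (card (insert e M))" using w1(3) by simp
    moreover have "pairwise disjoint_selections (insert e M)"
      using M(2) Me unfolding pairwise_insert disjoint_selections_def by metis
    moreover have "insert e M \<subseteq> {e. w e \<noteq> 0}"
    proof -
      have "w1 e \<noteq> 0" using e by auto
      then show ?thesis using M(1) w1(4) by (auto simp: w2_def split: if_splits)
    qed
    ultimately show ?thesis by (intro exI[of _ "insert e M"] conjI)
  qed
qed

section \<open>A coloured cover of the space of divisions by small sets\<close>

text \<open>
  The point \<open>u / 2\<close> is the centre of a face of the grid of unit cubes with integer corners; the face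
  extends in the directions where \<open>u\<close> is odd. The function \<open>bump I u\<close> is positive precisely
  on the open star of this centre in the barycentric subdivision of the grid: \<open>y\<close> is at distance less
  than \<open>1/2\<close> from the centre in every coordinate, and \<open>y\<close> is nearer to the integers in each coordinate
  where \<open>u\<close> is even than in each one where \<open>u\<close> is odd. Where \<open>u c\<close> is even and \<open>u d\<close> is odd, the
  distances to the integers are \<open>\<bar>y c - u c / 2\<bar>\<close> and \<open>1/2 - \<bar>y d - u d / 2\<bar>\<close>. A product of truncated differences makes continuity immediate.
\<close>

definition bump :: "'c set \<Rightarrow> ('c \<Rightarrow> nat) \<Rightarrow> ('c \<Rightarrow> real) \<Rightarrow> real" where
  "bump I u y =
     (\<Prod>c\<in>I. max 0 (1/2 - \<bar>y c - u c / 2\<bar>)) *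
     (\<Prod>c\<in>{c\<in>I. even (u c)}. \<Prod>d\<in>{d\<in>I. odd (u d)}.
        max 0 (1/2 - \<bar>y c - u c / 2\<bar> - \<bar>y d - u d / 2\<bar>))"

lemma bump_nonneg: "0 \<le> bump I u y"
  unfolding bump_def by (intro mult_nonneg_nonneg prod_nonneg) auto

lemma bump_pos_iff:
  assumes "finite I"
  shows "0 < bump I u y \<longleftrightarrow> (\<forall>c\<in>I. \<bar>y c - u c / 2\<bar> < 1/2) \<and>
    (\<forall>c\<in>I. \<forall>d\<in>I. even (u c) \<longrightarrow> odd (u d) \<longrightarrow> \<bar>y c - u c / 2\<bar> + \<bar>y d - u d / 2\<bar> < 1/2)"
proof -
  have max_pos: "max 0 a \<noteq> 0 \<longleftrightarrow> 0 < a" for a :: real by (auto simp: max_def)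
  have "0 < bump I u y \<longleftrightarrow> bump I u y \<noteq> 0" using bump_nonneg[of I u y] by linarith
  also have "\<dots> \<longleftrightarrow> (\<forall>c\<in>I. max 0 (1/2 - \<bar>y c - u c / 2\<bar>) \<noteq> 0) \<and>
     (\<forall>c\<in>{c\<in>I. even (u c)}. \<forall>d\<in>{d\<in>I. odd (u d)}. max 0 (1/2 - \<bar>y c - u c / 2\<bar> - \<bar>y d - u d / 2\<bar>) \<noteq> 0)"
    unfolding bump_def using assms by (simp add: prod_zero_iff) blast
  finally show ?thesis by (auto simp: max_pos algebra_simps)
qed

text \<open>
  The centre of the smallest grid face containing \<open>y\<close> will do. Its doubled coordinates are
  \<open>\<lfloor>y c\<rfloor> + \<lceil>y c\<rceil>\<close>, which is even exactly if \<open>y c\<close> is an integer.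
\<close>

lemma exists_bump_pos:
  assumes I: "finite I" and y: "\<And>c. c \<in> I \<Longrightarrow> 0 \<le> y c \<and> y c \<le> real L"
  shows "\<exists>u\<in>I \<rightarrow>\<^sub>E {0..2*L}. 0 < bump I u y"
proof -
  define u where "u = (\<lambda>c\<in>I. nat (\<lfloor>y c\<rfloor> + \<lceil>y c\<rceil>))"
  have val: "real (u c) = of_int \<lfloor>y c\<rfloor> + of_int \<lceil>y c\<rceil>" if "c \<in> I" for c
  proof -
    have "0 \<le> \<lfloor>y c\<rfloor> + \<lceil>y c\<rceil>" using y[OF that] by simp
    then show ?thesis using that by (simp add: u_def)
  qed
  have near: "\<bar>y c - u c / 2\<bar> < 1/2 \<and> (even (u c) \<longrightarrow> y c = u c / 2)" if c: "c \<in> I" for c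
  proof (cases "y c \<in> \<int>")
    case True
    then have "real_of_int \<lfloor>y c\<rfloor> = y c" "real_of_int \<lceil>y c\<rceil> = y c" by (auto elim: Ints_cases)
    then have "real (u c) = 2 * y c" using val[OF c] by linarith
    then show ?thesis by simp
  next
    case False
    then have ceil: "\<lceil>y c\<rceil> = \<lfloor>y c\<rfloor> + 1" by (simp add: ceiling_altdef Ints_def) (metis rangeI)
    have lt: "real_of_int \<lfloor>y c\<rfloor> < y c" using False by (metis Ints_of_int of_int_floor_le order_le_less)
    have "odd (u c)"
    proof -
      have "0 \<le> \<lfloor>y c\<rfloor> + \<lceil>y c\<rceil>" using y[OF c] by simp
      moreover have "u c = nat (\<lfloor>y c\<rfloor> + \<lceil>y c\<rceil>)" using c by (simp add: u_def)
      ultimately show ?thesis using ceil by (simp add: even_nat_iff)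
    qed
    moreover have "y c < real_of_int \<lfloor>y c\<rfloor> + 1" by linarith
    ultimately show ?thesis using val[OF c] ceil lt by (simp add: abs_less_iff field_simps)
  qed
  have "u c \<le> 2 * L" if c: "c \<in> I" for c
  proof -
    have "\<lfloor>y c\<rfloor> \<le> int L" "\<lceil>y c\<rceil> \<le> int L" using y[OF c] by (simp_all add: floor_le_iff ceiling_le_iff)
    then show ?thesis using c by (simp add: u_def)
  qed
  then have "u \<in> I \<rightarrow>\<^sub>E {0..2*L}" by (auto simp: u_def)
  moreover have "0 < bump I u y"
    unfolding bump_pos_iff[OF I] using near by fastforce
  ultimately show ?thesis by blast
qed

lemma half_integers_apart:
  fixes a b :: nat and t :: real
  assumes "a \<noteq> b"
  shows "1/2 \<le> \<bar>t - a/2\<bar> + \<bar>t - b/2\<bar>"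
proof -
  have "1 \<le> \<bar>real a - real b\<bar>" using assms by linarith
  then show ?thesis by linarith
qed

text \<open>
  The coordinates where \<open>u\<close> is even are the ones in which \<open>y\<close> is nearest to the integers, so their
  number determines them. If \<open>c\<close> were such a coordinate only for \<open>u\<close> and \<open>d\<close> only for \<open>v\<close>, then the four distances of \<open>y\<close> to
  the centres in these two coordinates would add up to less than 1, although in each coordinate the
  two centres are at least \<open>1/2\<close> apart.
\<close>

lemma bump_pos_unique:
  assumes I: "finite I" and uv: "u \<in> extensional I" "v \<in> extensional I"
    and pos: "0 < bump I u y" "0 < bump I v y"
    and card: "card {c\<in>I. even (u c)} = card {c\<in>I. even (v c)}"
  shows "u = v"
proof -
  let ?A = "{c\<in>I. even (u c)}" and ?B = "{c\<in>I. even (v c)}"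
  have "?A = ?B"
  proof (rule ccontr)
    assume ne: "?A \<noteq> ?B"
    have fin: "finite ?A" "finite ?B" using I by auto
    obtain c where c: "c \<in> ?A" "c \<notin> ?B" using ne card_subset_eq[OF fin(2) _ card] by blast
    obtain d where d: "d \<in> ?B" "d \<notin> ?A" using ne card_subset_eq[OF fin(1) _ card[symmetric]] by blast
    have "\<bar>y c - u c / 2\<bar> + \<bar>y d - u d / 2\<bar> < 1/2" "\<bar>y d - v d / 2\<bar> + \<bar>y c - v c / 2\<bar> < 1/2"
      using pos c d unfolding bump_pos_iff[OF I] by auto
    moreover have "1/2 \<le> \<bar>y c - u c / 2\<bar> + \<bar>y c - v c / 2\<bar>" "1/2 \<le> \<bar>y d - u d / 2\<bar> + \<bar>y d - v d / 2\<bar>"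
      using c d by (intro half_integers_apart; auto)+
    ultimately show False by linarith
  qed
  have "u c = v c" if c: "c \<in> I" for c
  proof -
    have "\<bar>y c - u c / 2\<bar> < 1/2" "\<bar>y c - v c / 2\<bar> < 1/2"
      using pos c unfolding bump_pos_iff[OF I] by auto
    then have "\<bar>real (u c) - real (v c)\<bar> < 2" by linarith
    moreover have "even (u c) \<longleftrightarrow> even (v c)" using \<open>?A = ?B\<close> c by blast
    moreover have "m = n" if "\<bar>real m - real n\<bar> < 2" "even m \<longleftrightarrow> even n" for m n :: nat
    proof -
      have "\<bar>int m - int n\<bar> < 2" using that(1) by linarith
      then show ?thesis using that(2) by presburger
    qed
    ultimately show ?thesis by blast
  qed
  then show ?thesis using uv by (intro extensionalityI) auto
qed

lemma divisionsD:
  assumes "x \<in> divisions"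
  shows "0 \<le> x $ j $ i" "x $ j $ i \<le> 1" "(\<Sum>i\<in>UNIV. x $ j $ i) = 1"
proof -
  have nn: "0 \<le> x $ j $ i" for i using assms by (simp add: divisions_def unit_simplex_def)
  have s: "(\<Sum>i\<in>UNIV. x $ j $ i) = 1" using assms by (simp add: divisions_def unit_simplex_def)
  show "0 \<le> x $ j $ i" "(\<Sum>i\<in>UNIV. x $ j $ i) = 1" using nn s by auto
  show "x $ j $ i \<le> 1" using member_le_sum[of i UNIV "\<lambda>i. x $ j $ i"] nn s by simp
qed

lemma divisionsI:
  assumes "\<And>j i. 0 \<le> x $ j $ i" "\<And>j. (\<Sum>i\<in>UNIV. x $ j $ i) = 1"
  shows "x \<in> divisions"
  using assms by (auto simp: divisions_def unit_simplex_def)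

text \<open>
  A coloured cover with as many colours as in the covering dimension theorem. A division is given by
  the coordinates in \<open>I\<close>, which omits one piece of each cake, as the widths in a cake add up to 1. There
  are \<open>k (n - 1)\<close> of them, so a grid face has one of \<open>k (n - 1) + 1\<close> dimensions; here the colour is the
  codimension.
\<close>

lemma coloured_cover:
  fixes \<delta> :: real
  assumes \<delta>: "0 < \<delta>"
  obtains U :: "('k::finite \<times> 'n::finite \<Rightarrow> nat) set" and colour :: "('k \<times> 'n \<Rightarrow> nat) \<Rightarrow> nat"
    and h :: "('k \<times> 'n \<Rightarrow> nat) \<Rightarrow> real ^ 'n ^ 'k \<Rightarrow> real"
  where "finite U" "\<And>u. u \<in> U \<Longrightarrow> colour u < CARD('k) * (CARD('n) - 1) + 1"
    and "\<And>u. continuous_on UNIV (h u)" "\<And>u x. 0 \<le> h u x"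
    and "\<And>x. x \<in> divisions \<Longrightarrow> \<exists>u\<in>U. 0 < h u x"
    and "\<And>x u v. u \<in> U \<Longrightarrow> v \<in> U \<Longrightarrow> 0 < h u x \<Longrightarrow> 0 < h v x \<Longrightarrow> colour u = colour v \<Longrightarrow> u = v"
    and "\<And>u x y j i. u \<in> U \<Longrightarrow> x \<in> divisions \<Longrightarrow> y \<in> divisions \<Longrightarrow> 0 < h u x \<Longrightarrow> 0 < h u y \<Longrightarrow>
       \<bar>x $ j $ i - y $ j $ i\<bar> \<le> \<delta>"
proof -
  \<comment> \<open>an arbitrary piece, whose width is recovered from the others\<close>
  define i0 :: 'n where "i0 = undefined"
  define I :: "('k \<times> 'n) set" where "I = UNIV \<times> (UNIV - {i0})"
  \<comment> \<open>In the omitted coordinate the differences of up to \<open>n - 1\<close> others add up, hence the factor \<open>n\<close>.\<close>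
  obtain L :: nat where L: "real CARD('n) / \<delta> < real L" using reals_Archimedean2 by blast
  have L0: "0 < real L" using L \<delta> by (smt (verit) divide_nonneg_pos of_nat_0_le_iff)
  have n1: "1 \<le> real CARD('n)" by (simp add: Suc_le_eq)
  have Ln: "real CARD('n) / real L \<le> \<delta>" using L L0 \<delta> by (simp add: field_simps)
  define U where "U = I \<rightarrow>\<^sub>E {0..2*L}"
  define colour where "colour u = card {c\<in>I. even (u c)}" for u :: "'k \<times> 'n \<Rightarrow> nat"
  define h where "h u x = bump I u (\<lambda>(j,i). real L * x $ j $ i)"
    for u and x :: "real ^ 'n ^ 'k"
  have I: "finite I" by simp
  have cI: "card I = CARD('k) * (CARD('n) - 1)" by (simp add: I_def card_cartesian_product)
  have U1: "finite U" unfolding U_def using I by (intro finite_PiE) auto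
  have U2: "colour u < CARD('k) * (CARD('n) - 1) + 1" for u
    using card_mono[OF I, of "{c\<in>I. even (u c)}"] cI by (auto simp: colour_def less_Suc_eq_le)
  have h1: "continuous_on UNIV (h u)" for u
    unfolding h_def bump_def case_prod_unfold by (auto intro!: continuous_intros)
  have h2: "0 \<le> h u x" for u x by (simp add: h_def bump_nonneg)
  have h3: "\<exists>u\<in>U. 0 < h u x" if x: "x \<in> divisions" for x
    unfolding h_def U_def using L0
    by (intro exists_bump_pos[OF I]) (auto simp: divisionsD[OF x] mult_le_cancel_left1)
  have h4: "u = v" if "u \<in> U" "v \<in> U" "0 < h u x" "0 < h v x" "colour u = colour v" for x u v
    using bump_pos_unique[OF I] that unfolding h_def colour_def U_def by (auto simp: PiE_iff)
  have h5: "\<bar>x $ j $ i - y $ j $ i\<bar> \<le> \<delta>"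
    if "u \<in> U" and x: "x \<in> divisions" and y: "y \<in> divisions" and h: "0 < h u x" "0 < h u y" for u x y j i
  proof -
    have close: "\<bar>x $ j $ i - y $ j $ i\<bar> \<le> 1 / real L" if "i \<noteq> i0" for i
    proof -
      have "(j, i) \<in> I" using that by (simp add: I_def)
      then have "\<bar>real L * x $ j $ i - u (j,i) / 2\<bar> < 1/2" "\<bar>real L * y $ j $ i - u (j,i) / 2\<bar> < 1/2"
        using h unfolding h_def bump_pos_iff[OF I] by fastforce+
      then have "\<bar>real L * x $ j $ i - real L * y $ j $ i\<bar> \<le> 1" by linarith
      then have "real L * \<bar>x $ j $ i - y $ j $ i\<bar> \<le> 1"
        using L0 by (simp add: abs_mult right_diff_distrib[symmetric])
      then show ?thesis using L0 by (simp add: field_simps)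
    qed
    show ?thesis
    proof (cases "i = i0")
      case False
      have "\<bar>x $ j $ i - y $ j $ i\<bar> \<le> 1 / real L" using close False .
      also have "\<dots> \<le> real CARD('n) / real L" using n1 L0 by (intro divide_right_mono) auto
      finally show ?thesis using Ln by simp
    next
      case True
      have last: "z $ j $ i0 = 1 - (\<Sum>i\<in>UNIV - {i0}. z $ j $ i)" if "z \<in> divisions" for z :: "real ^ 'n ^ 'k"
        using divisionsD(3)[OF that, of j] sum.remove[of UNIV i0 "\<lambda>i. z $ j $ i"] by simp
      have "x $ j $ i0 - y $ j $ i0 = (\<Sum>i\<in>UNIV - {i0}. y $ j $ i - x $ j $ i)"
        using last[OF x] last[OF y] by (simp add: sum_subtractf)
      also have "\<bar>\<dots>\<bar> \<le> (\<Sum>i\<in>UNIV - {i0}. 1 / real L)"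
        using close by (intro order_trans[OF sum_abs] sum_mono) (auto simp: abs_minus_commute)
      also have "\<dots> \<le> real CARD('n) / real L"
        using L0 by (simp add: divide_right_mono)
      finally show ?thesis using Ln True by simp
    qed
  qed
  show thesis by (rule that[of U colour h]) (assumption | rule U1 U2 h1 h2 | erule h3 | erule (4) h4 | erule (4) h5)+
qed

section \<open>Maps preserving faces reach the barycentre\<close>

lemma compact_divisions: "compact (divisions :: (real ^ 'n::finite ^ 'k::finite) set)"
proof -
  have eq: "(divisions :: (real ^ 'n ^ 'k) set)
      = {x. \<forall>j. (\<forall>i. 0 \<le> x $ j $ i) \<and> (\<Sum>i\<in>UNIV. x $ j $ i) = 1}"
    by (auto simp: divisions_def unit_simplex_def)
  have "closed (divisions :: (real ^ 'n ^ 'k) set)" unfolding eq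
    by (intro closed_Collect_all closed_Collect_conj closed_Collect_le closed_Collect_eq continuous_intros)
  moreover have "norm x \<le> real CARD('k) * real CARD('n)" if x: "x \<in> divisions" for x :: "real ^ 'n ^ 'k"
  proof -
    have "norm (x $ j) \<le> real CARD('n)" for j
    proof -
      have "norm (x $ j) \<le> (\<Sum>i\<in>UNIV. \<bar>x $ j $ i\<bar>)" by (rule norm_le_l1_cart)
      also have "\<dots> \<le> (\<Sum>i\<in>(UNIV::'n set). 1)"
        using divisionsD[OF x] by (intro sum_mono) auto
      finally show ?thesis by simp
    qed
    moreover have "norm x \<le> (\<Sum>j\<in>UNIV. norm (x $ j))"
      unfolding norm_vec_def by (rule L2_set_le_sum) auto
    ultimately show ?thesis
      using sum_mono[of UNIV "\<lambda>j. norm (x $ j)" "\<lambda>_. real CARD('n)"] by fastforce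
  qed
  then have "bounded (divisions :: (real ^ 'n ^ 'k) set)" by (auto simp: bounded_iff)
  ultimately show ?thesis by (simp add: compact_eq_bounded_closed)
qed

lemma convex_divisions: "convex (divisions :: (real ^ 'n::finite ^ 'k::finite) set)"
proof (rule convexI)
  fix x y :: "real ^ 'n ^ 'k" and a b :: real
  assume "x \<in> divisions" "y \<in> divisions" "0 \<le> a" "0 \<le> b" "a + b = 1"
  then show "a *\<^sub>R x + b *\<^sub>R y \<in> divisions"
    by (intro divisionsI) (auto simp: divisionsD sum.distrib sum_distrib_left[symmetric])
qed

lemma barycentre_division: "(\<chi> j i. 1 / real CARD('n)) \<in> (divisions :: (real ^ 'n::finite ^ 'k::finite) set)"
  by (intro divisionsI) auto

text \<open>
  Brouwer's theorem is applied to the map that widens the pieces whose width in \<open>F x\<close> is below \<open>1/n\<close> and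
  rescales. If some piece of cake \<open>j\<close> were deficient at a fixed point, the deficits would be
  proportional to the widths in \<open>x\<close>. An empty piece has deficit \<open>1/n\<close> by the face condition, so no piece
  is empty, hence all pieces of the cake are deficient, which is impossible as their widths in \<open>F x\<close> add
  up to 1.
\<close>

lemma face_preserving_hits_barycentre:
  fixes F :: "real ^ 'n::finite ^ 'k::finite \<Rightarrow> real ^ 'n ^ 'k"
  assumes cont: "continuous_on divisions F" and maps: "F ` divisions \<subseteq> divisions"
    and face: "\<And>x j i. x \<in> divisions \<Longrightarrow> x $ j $ i = 0 \<Longrightarrow> F x $ j $ i = 0"
  shows "\<exists>x\<in>divisions. \<forall>j i. F x $ j $ i = 1 / real CARD('n)"
proof -
  let ?b = "1 / real CARD('n)"
  \<comment> \<open>the deficit of a piece in \<open>F x\<close>\<close>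
  define d where "d x j i = max 0 (?b - F x $ j $ i)" for x j i
  define S where "S x j = (\<Sum>i\<in>UNIV. d x j i)" for x j
  define G where "G x = (\<chi> j i. (x $ j $ i + d x j i) / (1 + S x j))" for x
  have d0: "0 \<le> d x j i" for x j i by (simp add: d_def)
  have S0: "0 \<le> S x j" for x j unfolding S_def by (intro sum_nonneg d0)
  have S1: "1 + S x j \<noteq> 0" for x j using S0[of x j] by linarith
  have "G x \<in> divisions" if x: "x \<in> divisions" for x
  proof (rule divisionsI)
    show "0 \<le> G x $ j $ i" for j i
      using divisionsD(1)[OF x, of j i] d0[of x j i] S0[of x j] by (simp add: G_def)
    show "(\<Sum>i\<in>UNIV. G x $ j $ i) = 1" for j
      using divisionsD(3)[OF x, of j] S1[of x j]
      by (simp add: G_def sum_divide_distrib[symmetric] sum.distrib S_def[symmetric])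
  qed
  moreover have "continuous_on divisions G"
    unfolding G_def S_def d_def
    using S1 cont by (intro continuous_intros) (auto simp: S_def d_def)
  moreover have "(divisions :: (real ^ 'n ^ 'k) set) \<noteq> {}" using barycentre_division by blast
  ultimately obtain x where x: "x \<in> divisions" "G x = x"
    using brouwer[OF compact_divisions convex_divisions] by blast
  have fixed: "d x j i = x $ j $ i * S x j" for j i
  proof -
    have "(x $ j $ i + d x j i) / (1 + S x j) = x $ j $ i" using x(2) by (simp add: G_def vec_eq_iff)
    then show ?thesis using S1[of x j] by (simp add: field_simps)
  qed
  have Fx: "F x \<in> divisions" using maps x by blast
  have b0: "0 < ?b" by simp
  have S: "S x j = 0" for j
  proof (rule ccontr)
    assume "S x j \<noteq> 0"
    then have "0 < S x j" using S0[of x j] by simp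
    have "F x $ j $ i < ?b" for i
    proof (cases "x $ j $ i = 0")
      case True then show ?thesis using face[OF x(1) True] b0 by simp
    next
      case False
      then have "0 < d x j i" using fixed[of j i] \<open>0 < S x j\<close> divisionsD(1)[OF x(1), of j i] by simp
      then show ?thesis by (simp add: d_def max_def split: if_splits)
    qed
    then have "(\<Sum>i\<in>UNIV. F x $ j $ i) < (\<Sum>i\<in>(UNIV::'n set). ?b)"
      by (intro sum_strict_mono) auto
    then show False using divisionsD(3)[OF Fx, of j] by simp
  qed
  have ge: "?b \<le> F x $ j $ i" for j i
    using fixed[of j i] S[of j] by (simp add: d_def max_def split: if_splits)
  have "F x $ j $ i = ?b" for j i
  proof (rule ccontr)
    assume "F x $ j $ i \<noteq> ?b"
    with ge have "?b < F x $ j $ i" by (simp add: order.strict_iff_order)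
    then have "(\<Sum>i\<in>(UNIV::'n set). ?b) < (\<Sum>i\<in>UNIV. F x $ j $ i)"
      using ge by (intro sum_strict_mono_ex1) auto
    then show False using divisionsD(3)[OF Fx, of j] by simp
  qed
  then show ?thesis using x(1) by blast
qed

section \<open>A colourful cover theorem for products of simplices\<close>

text \<open>
  Labels are taken from the modified division \<open>y\<close>. A hungry player who accepts a selection in \<open>y\<close> avoids
  every piece that is merely narrow in \<open>x\<close>, which is what makes the labelling respect the boundary.
\<close>

lemma remove_small_pieces:
  fixes x :: "real ^ 'n::finite ^ 'k::finite"
  assumes x: "x \<in> divisions" and e: "0 \<le> e" "real CARD('n) * e < 1"
  shows "\<exists>y\<in>divisions. \<forall>j i. (x $ j $ i \<le> e \<longrightarrow> y $ j $ i = 0) \<and>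
           \<bar>y $ j $ i - x $ j $ i\<bar> \<le> real CARD('n) * e"
proof -
  let ?n = "real CARD('n)"
  define a where "a j i = max 0 (x $ j $ i - e)" for j i
  define S where "S j = (\<Sum>i\<in>UNIV. a j i)" for j
  define y where "y = (\<chi> j i. a j i / S j)"
  have a0: "0 \<le> a j i" and age: "x $ j $ i - e \<le> a j i" and ale: "a j i \<le> x $ j $ i" for j i
    using divisionsD(1)[OF x, of j i] e(1) by (auto simp: a_def)
  have "1 - ?n * e \<le> S j" for j
  proof -
    have "1 - ?n * e = (\<Sum>i\<in>UNIV. x $ j $ i - e)" by (simp add: sum_subtractf divisionsD(3)[OF x])
    also have "\<dots> \<le> S j" unfolding S_def using age by (intro sum_mono)
    finally show ?thesis .
  qed
  then have S0: "0 < S j" for j using e(2) by (smt (verit))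
  have S1: "S j \<le> 1" for j
  proof -
    have "S j \<le> (\<Sum>i\<in>UNIV. x $ j $ i)" unfolding S_def using ale by (intro sum_mono)
    then show ?thesis by (simp add: divisionsD(3)[OF x])
  qed
  have y: "y \<in> divisions"
  proof (rule divisionsI)
    show "0 \<le> y $ j $ i" for j i using a0[of j i] S0[of j] by (simp add: y_def)
    show "(\<Sum>i\<in>UNIV. y $ j $ i) = 1" for j
      using S0[of j] by (simp add: y_def sum_divide_distrib[symmetric] S_def[symmetric])
  qed
  have ge: "x $ j $ i - e \<le> y $ j $ i" for j i
  proof -
    have "a j i * S j \<le> a j i * 1" using S1[of j] a0[of j i] by (intro mult_left_mono)
    then have "a j i \<le> y $ j $ i" using S0[of j] by (simp add: y_def pos_le_divide_eq)
    then show ?thesis using age[of j i] by linarith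
  qed
  have "y $ j $ i \<le> x $ j $ i + ?n * e" for j i
  proof -
    have "(\<Sum>i\<in>UNIV - {i}. x $ j $ i - e) \<le> (\<Sum>i\<in>UNIV - {i}. y $ j $ i)" using ge by (intro sum_mono)
    moreover have "(\<Sum>i\<in>UNIV - {i}. z $ j $ i) = 1 - z $ j $ i" if "z \<in> divisions" for z :: "real ^ 'n ^ 'k"
      using divisionsD(3)[OF that, of j] sum.remove[of UNIV i "\<lambda>i. z $ j $ i"] by simp
    ultimately have "y $ j $ i \<le> x $ j $ i + real (card (UNIV - {i} :: 'n set)) * e"
      using x y by (simp add: sum_subtractf)
    also have "\<dots> \<le> x $ j $ i + ?n * e"
      using e(1) by (intro add_left_mono mult_right_mono) (auto intro: card_mono)
    finally show ?thesis .
  qed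
  moreover have "x $ j $ i - ?n * e \<le> y $ j $ i" for j i
  proof -
    have "1 * e \<le> ?n * e" using e(1) by (intro mult_right_mono) (simp_all add: Suc_le_eq)
    then show ?thesis using ge[of j i] by linarith
  qed
  moreover have "y $ j $ i = 0" if "x $ j $ i \<le> e" for j i using that by (simp add: y_def a_def)
  ultimately show ?thesis using y by (intro bexI[of _ y]) (auto simp: abs_le_iff algebra_simps)
qed

text \<open>
  \<open>R\<close> pairs colours with selections, \<open>single_valued\<close> allowing at most one selection for each
  colour. The weights express that the barycentre of the space of divisions lies in the convex hull of
  the vertices belonging to the selections of \<open>R\<close>. The condition involves no division, and there are
  only finitely many candidates for \<open>R\<close>; both matter for the passage to the limit.
\<close>

definition balanced_rainbow :: "nat \<Rightarrow> (nat \<times> ('n::finite, 'k::finite) selection) set \<Rightarrow> bool" where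
  "balanced_rainbow D R \<longleftrightarrow> R \<subseteq> {..<D} \<times> UNIV \<and> single_valued R \<and>
     (\<exists>\<mu>. (\<forall>r\<in>R. 0 \<le> \<mu> r) \<and> (\<forall>j i. (\<Sum>r | r \<in> R \<and> snd r j = i. \<mu> r) = 1 / real CARD('n)))"

text \<open>
  The sets of a coloured cover receive labels, and \<open>F x\<close> is the average of the vertices belonging to the
  labels of the sets around \<open>x\<close>. Where \<open>F x\<close> is the barycentre, these sets have distinct colours, and
  their labels form a balanced rainbow.
\<close>

lemma approximate_rainbow:
  fixes C :: "nat \<Rightarrow> ('n::finite, 'k::finite) preferences"
  assumes D: "D = CARD('k) * (CARD('n) - 1) + 1"
    and hungry: "\<And>m. m < D \<Longrightarrow> hungry (C m)"
    and accepts: "\<And>m. m < D \<Longrightarrow> always_accepts (C m)"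
    and \<delta>: "0 < \<delta>"
  shows "\<exists>x\<in>divisions. \<exists>R. balanced_rainbow D R \<and>
           (\<forall>(m,s)\<in>R. \<exists>y\<in>C m s. \<forall>j i. \<bar>y $ j $ i - x $ j $ i\<bar> \<le> \<delta>)"
proof -
  let ?n = "real CARD('n)"
  have n: "1 \<le> ?n" by (simp add: Suc_le_eq)
  \<comment> \<open>The label of a set is taken within \<open>n e\<close> of one of its points, and the set has width at most \<open>e\<close> in each coordinate.\<close>
  define e where "e = min \<delta> 1 / (2 * ?n)"
  have e: "0 < e" "?n * e < 1" "?n * e + e \<le> \<delta>"
  proof -
    show "0 < e" using \<delta> n by (simp add: e_def)
    have ne: "?n * e = min \<delta> 1 / 2" using n by (simp add: e_def)
    then show "?n * e < 1" by linarith
    have "1 * e \<le> ?n * e" using \<open>0 < e\<close> n by (intro mult_right_mono) auto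
    then show "?n * e + e \<le> \<delta>" using ne by linarith
  qed
  obtain U :: "('k \<times> 'n \<Rightarrow> nat) set" and colour :: "('k \<times> 'n \<Rightarrow> nat) \<Rightarrow> nat"
    and h :: "('k \<times> 'n \<Rightarrow> nat) \<Rightarrow> real ^ 'n ^ 'k \<Rightarrow> real"
    where U: "finite U" "\<And>u. u \<in> U \<Longrightarrow> colour u < D"
      and hcont: "\<And>u. continuous_on UNIV (h u)" and h0: "\<And>u x. 0 \<le> h u x"
      and hpos: "\<And>x. x \<in> divisions \<Longrightarrow> \<exists>u\<in>U. 0 < h u x"
      and huniq: "\<And>x u v. u \<in> U \<Longrightarrow> v \<in> U \<Longrightarrow> 0 < h u x \<Longrightarrow> 0 < h v x \<Longrightarrow> colour u = colour v \<Longrightarrow> u = v"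
      and hsmall: "\<And>u x y j i. u \<in> U \<Longrightarrow> x \<in> divisions \<Longrightarrow> y \<in> divisions \<Longrightarrow> 0 < h u x \<Longrightarrow> 0 < h u y \<Longrightarrow>
         \<bar>x $ j $ i - y $ j $ i\<bar> \<le> e"
    unfolding D by (rule coloured_cover[OF e(1), where 'n='n and 'k='k]) blast
  have "\<exists>s. \<exists>y\<in>C (colour u) s. \<forall>x\<in>divisions. 0 < h u x \<longrightarrow>
      (\<forall>j i. \<bar>y $ j $ i - x $ j $ i\<bar> \<le> \<delta>) \<and> (\<forall>j. x $ j $ s j \<noteq> 0)" if u: "u \<in> U" for u
  proof (cases "\<exists>z\<in>divisions. 0 < h u z")
    case False
    obtain s where "(\<chi> j i. 1 / ?n) \<in> C (colour u) s"
      using accepts[OF U(2)[OF u]] barycentre_division unfolding always_accepts_def by blast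
    then show ?thesis using False by blast
  next
    case True
    then obtain z where z: "z \<in> divisions" "0 < h u z" by blast
    obtain y where y: "y \<in> divisions" "\<And>j i. z $ j $ i \<le> e \<Longrightarrow> y $ j $ i = 0"
      "\<And>j i. \<bar>y $ j $ i - z $ j $ i\<bar> \<le> ?n * e"
      using remove_small_pieces[OF z(1) less_imp_le[OF e(1)] e(2)] by blast
    obtain s where s: "y \<in> C (colour u) s"
      using accepts[OF U(2)[OF u]] y(1) unfolding always_accepts_def by blast
    have "\<bar>y $ j $ i - x $ j $ i\<bar> \<le> \<delta>" if "x \<in> divisions" "0 < h u x" for x j i
      using hsmall[OF u z(1) that(1) z(2) that(2), of j i] y(3)[of j i] e(3) by linarith
    moreover have "x $ j $ s j \<noteq> 0" if x: "x \<in> divisions" "0 < h u x" for x j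
    proof
      assume "x $ j $ s j = 0"
      then have "z $ j $ s j \<le> e" using hsmall[OF u z(1) x(1) z(2) x(2), of j "s j"] by linarith
      then have "y $ j $ s j = 0" by (rule y(2))
      then show False
        using hungry[OF U(2)[OF u]] y(1) s unfolding hungry_def empty_piece_def by blast
    qed
    ultimately show ?thesis using s by blast
  qed
  then have "\<forall>u\<in>U. \<exists>s. \<exists>y\<in>C (colour u) s. \<forall>x\<in>divisions. 0 < h u x \<longrightarrow>
      (\<forall>j i. \<bar>y $ j $ i - x $ j $ i\<bar> \<le> \<delta>) \<and> (\<forall>j. x $ j $ s j \<noteq> 0)" by blast
  from bchoice[OF this] obtain s where s: "\<And>u. u \<in> U \<Longrightarrow> \<exists>y\<in>C (colour u) (s u).
      \<forall>x\<in>divisions. 0 < h u x \<longrightarrow>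
        (\<forall>j i. \<bar>y $ j $ i - x $ j $ i\<bar> \<le> \<delta>) \<and> (\<forall>j. x $ j $ s u j \<noteq> 0)" by blast
  define H where "H x = (\<Sum>u\<in>U. h u x)" for x
  have H: "0 < H x" if "x \<in> divisions" for x
  proof -
    obtain u where "u \<in> U" "0 < h u x" using hpos[OF \<open>x \<in> divisions\<close>] by blast
    then show ?thesis unfolding H_def using U(1) h0 by (intro sum_pos2) auto
  qed
  define F :: "real ^ 'n ^ 'k \<Rightarrow> real ^ 'n ^ 'k"
    where "F x = (\<chi> j i. (\<Sum>u\<in>U. h u x * (if s u j = i then 1 else 0)) / H x)" for x
  have "continuous_on divisions (h u)" for u using hcont continuous_on_subset by blast
  then have "continuous_on divisions F"
    unfolding F_def H_def using H by (intro continuous_intros) (force simp: H_def)+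
  moreover have "F ` divisions \<subseteq> divisions"
  proof safe
    fix x :: "real ^ 'n ^ 'k" assume x: "x \<in> divisions"
    show "F x \<in> divisions"
    proof (rule divisionsI)
      show "0 \<le> F x $ j $ i" for j i
        using H[OF x] h0 by (simp add: F_def sum_nonneg)
      show "(\<Sum>i\<in>UNIV. F x $ j $ i) = 1" for j
      proof -
        have "(\<Sum>i\<in>UNIV. F x $ j $ i) = (\<Sum>i\<in>UNIV. \<Sum>u\<in>U. h u x * (if s u j = i then 1 else 0)) / H x"
          by (simp add: F_def sum_divide_distrib)
        also have "(\<Sum>i\<in>UNIV. \<Sum>u\<in>U. h u x * (if s u j = i then 1 else 0)) = H x"
          unfolding H_def by (subst sum.swap) (simp add: sum_distrib_left[symmetric])
        finally show ?thesis using H[OF x] by simp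
      qed
    qed
  qed
  moreover have "F x $ j $ i = 0" if x: "x \<in> divisions" and z: "x $ j $ i = 0" for x j i
  proof -
    have "h u x * (if s u j = i then 1 else 0) = 0" if u: "u \<in> U" for u
      using s[OF u] x z h0[of u x] by (auto simp: order.order_iff_strict)
    then have "(\<Sum>u\<in>U. h u x * (if s u j = i then 1 else 0)) = 0" by (intro sum.neutral ballI)
    then show ?thesis by (simp add: F_def)
  qed
  ultimately obtain x where x: "x \<in> divisions" "\<And>j i. F x $ j $ i = 1 / ?n"
    using face_preserving_hits_barycentre by blast
  define A where "A = {u\<in>U. 0 < h u x}"
  define g where "g u = (colour u, s u)" for u
  have inj: "inj_on g A" using huniq by (auto simp: inj_on_def A_def g_def)
  define \<mu> where "\<mu> r = h (inv_into A g r) x / H x" for r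
  have "(\<Sum>r | r \<in> g ` A \<and> snd r j = i. \<mu> r) = 1 / ?n" for j i
  proof -
    have "{r. r \<in> g ` A \<and> snd r j = i} = g ` {u\<in>A. s u j = i}" by (auto simp: g_def)
    then have "(\<Sum>r | r \<in> g ` A \<and> snd r j = i. \<mu> r) = (\<Sum>u | u \<in> A \<and> s u j = i. \<mu> (g u))"
      using inj by (simp add: sum.reindex inj_on_def)
    also have "\<dots> = (\<Sum>u | u \<in> A \<and> s u j = i. h u x / H x)"
      using inj by (intro sum.cong) (auto simp: \<mu>_def)
    also have "\<dots> = (\<Sum>u\<in>U. h u x * (if s u j = i then 1 else 0) / H x)"
      using U(1) h0[of _ x] by (intro sum.mono_neutral_cong_left) (auto simp: A_def order.order_iff_strict)
    also have "\<dots> = F x $ j $ i" by (simp add: F_def sum_divide_distrib)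
    finally show ?thesis using x(2) by simp
  qed
  moreover have "0 \<le> \<mu> r" for r using h0 H[OF x(1)] by (simp add: \<mu>_def)
  moreover have "g ` A \<subseteq> {..<D} \<times> UNIV" using U(2) by (auto simp: A_def g_def)
  moreover have "single_valued (g ` A)"
    using huniq unfolding single_valued_def A_def g_def by blast
  ultimately have "balanced_rainbow D (g ` A)" unfolding balanced_rainbow_def by blast
  moreover have "\<forall>(m, t)\<in>g ` A. \<exists>y\<in>C m t. \<forall>j i. \<bar>y $ j $ i - x $ j $ i\<bar> \<le> \<delta>"
  proof
    fix r assume "r \<in> g ` A"
    then obtain u where u: "u \<in> U" "0 < h u x" "r = (colour u, s u)" by (auto simp: A_def g_def)
    show "case r of (m, t) \<Rightarrow> \<exists>y\<in>C m t. \<forall>j i. \<bar>y $ j $ i - x $ j $ i\<bar> \<le> \<delta>"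
      unfolding u(3) prod.case using s[OF u(1)] x(1) u(2) by blast
  qed
  ultimately show ?thesis using x(1) by blast
qed

lemma tendsto_entries:
  fixes x y :: "nat \<Rightarrow> real ^ 'n::finite ^ 'k::finite"
  assumes x: "x \<longlonglongrightarrow> l" and c: "c \<longlonglongrightarrow> 0" and xy: "\<And>N j i. \<bar>y N $ j $ i - x N $ j $ i\<bar> \<le> c N"
  shows "y \<longlonglongrightarrow> l"
proof (intro vec_tendstoI)
  fix j i
  have "(\<lambda>N. y N $ j $ i - x N $ j $ i) \<longlonglongrightarrow> 0"
    by (rule Lim_null_comparison[OF _ c]) (use xy in auto)
  moreover have "(\<lambda>N. x N $ j $ i) \<longlonglongrightarrow> l $ j $ i" using x by (intro tendsto_intros)
  ultimately have "(\<lambda>N. (y N $ j $ i - x N $ j $ i) + x N $ j $ i) \<longlonglongrightarrow> 0 + l $ j $ i"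
    by (rule tendsto_add)
  then show "(\<lambda>N. y N $ j $ i) \<longlonglongrightarrow> l $ j $ i" by simp
qed

text \<open>
  A colourful version, with \<open>D\<close> colours, of the theorem of Knaster, Kuratowski and Mazurkiewicz for a
  product of simplices. Among the approximate solutions with error \<open>1 / (N + 1)\<close> one set \<open>R\<close> occurs infinitely
  often; along a convergent subsequence of the corresponding divisions closedness passes acceptance on
  to the limit.
\<close>

theorem balanced_rainbow_exists:
  fixes C :: "nat \<Rightarrow> ('n::finite, 'k::finite) preferences"
  assumes D: "D = CARD('k) * (CARD('n) - 1) + 1"
    and closed: "\<And>m. m < D \<Longrightarrow> closed_preferences (C m)"
    and hungry: "\<And>m. m < D \<Longrightarrow> hungry (C m)"
    and accepts: "\<And>m. m < D \<Longrightarrow> always_accepts (C m)"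
  shows "\<exists>x\<in>divisions. \<exists>R. balanced_rainbow D R \<and> (\<forall>(m,s)\<in>R. x \<in> C m s)"
proof -
  have "\<forall>N. \<exists>x R. x \<in> divisions \<and> balanced_rainbow D R \<and>
    (\<forall>(m,s)\<in>R. \<exists>y\<in>C m s. \<forall>j i. \<bar>y $ j $ i - x $ j $ i\<bar> \<le> inverse (real (Suc N)))"
  proof
    fix N
    have "0 < inverse (real (Suc N))" by simp
    from approximate_rainbow[of D C, OF D hungry accepts this]
    show "\<exists>x R. x \<in> divisions \<and> balanced_rainbow D R \<and>
      (\<forall>(m,s)\<in>R. \<exists>y\<in>C m s. \<forall>j i. \<bar>y $ j $ i - x $ j $ i\<bar> \<le> inverse (real (Suc N)))" by blast
  qed
  from choice[OF this] obtain X where "\<forall>N. \<exists>R. X N \<in> divisions \<and> balanced_rainbow D R \<and>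
    (\<forall>(m,s)\<in>R. \<exists>y\<in>C m s. \<forall>j i. \<bar>y $ j $ i - X N $ j $ i\<bar> \<le> inverse (real (Suc N)))" ..
  from choice[OF this] obtain R where XR': "\<forall>N. X N \<in> divisions \<and> balanced_rainbow D (R N) \<and>
    (\<forall>(m,s)\<in>R N. \<exists>y\<in>C m s. \<forall>j i. \<bar>y $ j $ i - X N $ j $ i\<bar> \<le> inverse (real (Suc N)))" ..
  then have X: "\<And>N. X N \<in> divisions" and R: "\<And>N. balanced_rainbow D (R N)" by blast+
  have XR: "\<exists>y\<in>C m s. \<forall>j i. \<bar>y $ j $ i - X N $ j $ i\<bar> \<le> inverse (real (Suc N))"
    if "(m, s) \<in> R N" for N m s using XR' that by fast
  have "range R \<subseteq> Pow ({..<D} \<times> UNIV)" using R unfolding balanced_rainbow_def by blast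
  then have "finite (range R)" by (rule finite_subset) simp
  then obtain N0 where "infinite {N. R N = R N0}"
    using pigeonhole_infinite[of UNIV R] by auto
  then obtain r :: "nat \<Rightarrow> nat" where r: "strict_mono r" "\<And>N. R (r N) = R N0"
    using infinite_enumerate by blast
  obtain x r' where x: "x \<in> divisions" and r': "strict_mono r'" "((X \<circ> r) \<circ> r') \<longlonglongrightarrow> x"
    using compact_divisions[unfolded compact_def, rule_format, of "X \<circ> r"] X by auto
  define g where "g = r \<circ> r'"
  have g: "strict_mono g" "(\<lambda>N. X (g N)) \<longlonglongrightarrow> x" "\<And>N. R (g N) = R N0"
    using r r' strict_mono_o[OF r(1) r'(1)] by (simp_all add: g_def o_def)
  have "x \<in> C m s" if ms: "(m, s) \<in> R N0" for m s
  proof -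
    have "\<forall>N. \<exists>y\<in>C m s. \<forall>j i. \<bar>y $ j $ i - X (g N) $ j $ i\<bar> \<le> inverse (real (Suc N))"
    proof
      fix N
      have "(m, s) \<in> R (g N)" using ms g(3) by simp
      from XR[OF this] obtain y where y: "y \<in> C m s"
        "\<And>j i. \<bar>y $ j $ i - X (g N) $ j $ i\<bar> \<le> inverse (real (Suc (g N)))" by blast
      have "inverse (real (Suc (g N))) \<le> inverse (real (Suc N))"
        using strict_mono_imp_increasing[OF g(1), of N] by simp
      then show "\<exists>y\<in>C m s. \<forall>j i. \<bar>y $ j $ i - X (g N) $ j $ i\<bar> \<le> inverse (real (Suc N))"
        using y by (meson order_trans)
    qed
    then have "\<forall>N. \<exists>y. y \<in> C m s \<and> (\<forall>j i. \<bar>y $ j $ i - X (g N) $ j $ i\<bar> \<le> inverse (real (Suc N)))"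
      unfolding Bex_def .
    from choice[OF this] obtain Y where Y: "\<And>N. Y N \<in> C m s"
      "\<And>N j i. \<bar>Y N $ j $ i - X (g N) $ j $ i\<bar> \<le> inverse (real (Suc N))" by blast
    have "Y \<longlonglongrightarrow> x"
      using tendsto_entries[OF g(2) LIMSEQ_inverse_real_of_nat Y(2)] .
    moreover have "closed (C m s)"
      using closed[of m] ms R[of N0] unfolding closed_preferences_def balanced_rainbow_def by blast
    ultimately show ?thesis using Y(1) closed_sequentially by blast
  qed
  then show ?thesis using x R[of N0] by (intro bexI[of _ x] exI[of _ "R N0"]) auto
qed

section \<open>Distributing the colours among the players\<close>

text \<open>
  The weights of a balanced rainbow, multiplied by \<open>n\<close>, are a fractional matching of total weight \<open>n\<close>.
  Distinct selections of the resulting matching have distinct colours, and at most \<open>q\<close> colours belong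
  to the same player.
\<close>

theorem satisfied_players_of_assignment:
  fixes C :: "'p \<Rightarrow> ('n::finite, 'k::finite) preferences" and \<pi> :: "nat \<Rightarrow> 'p"
  assumes k: "CARD('k) \<ge> 2" and D: "D = CARD('k) * (CARD('n) - 1) + 1"
    and closed: "\<And>m. m < D \<Longrightarrow> closed_preferences (C (\<pi> m))"
    and hungry: "\<And>m. m < D \<Longrightarrow> hungry (C (\<pi> m))"
    and accepts: "\<And>m. m < D \<Longrightarrow> always_accepts (C (\<pi> m))"
    and q: "\<And>i. card {m. m < D \<and> \<pi> m = i} \<le> q"
  shows "\<exists>x\<in>divisions. \<exists>N\<subseteq>\<pi> ` {..<D}.
           real CARD('n) \<le> (real CARD('k) - 1) * (real q * real (card N)) \<and> jointly_satisfied C x N"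
proof -
  let ?n = "real CARD('n)"
  obtain x R where x: "x \<in> divisions" and R: "balanced_rainbow D R" and acc: "\<forall>(m,s)\<in>R. x \<in> C (\<pi> m) s"
    using balanced_rainbow_exists[OF D, of "\<lambda>m. C (\<pi> m)"] closed hungry accepts by blast
  then obtain \<mu> where RD: "R \<subseteq> {..<D} \<times> UNIV" and sv: "single_valued R" and
    \<mu>0: "\<And>r. r \<in> R \<Longrightarrow> 0 \<le> \<mu> r" and \<mu>: "\<And>j i. (\<Sum>r | r \<in> R \<and> snd r j = i. \<mu> r) = 1 / ?n"
    unfolding balanced_rainbow_def by blast
  have finR: "finite R" using RD by (rule finite_subset) simp
  define w where "w e = ?n * (\<Sum>r | r \<in> R \<and> snd r = e. \<mu> r)" for e
  have load: "load w j i = 1" for j i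
  proof -
    have "load w j i = ?n * (\<Sum>e | e j = i. \<Sum>r | r \<in> R \<and> snd r = e. \<mu> r)"
      by (simp add: load_def w_def sum_distrib_left)
    also have "(\<Sum>e | e j = i. \<Sum>r | r \<in> R \<and> snd r = e. \<mu> r)
        = (\<Sum>e | e j = i. \<Sum>r | r \<in> {r\<in>R. snd r j = i} \<and> snd r = e. \<mu> r)"
      by (intro sum.cong) auto
    also have "\<dots> = (\<Sum>r | r \<in> R \<and> snd r j = i. \<mu> r)"
      using finR by (subst sum.group) auto
    finally show ?thesis using \<mu> by simp
  qed
  have "fractional_matching w"
  proof (rule fractional_matchingI)
    show "0 \<le> w e" for e using \<mu>0 by (auto simp: w_def intro!: mult_nonneg_nonneg sum_nonneg)
  qed (simp add: load)
  from fractional_matching_imp_matching[OF k this] obtain M where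
    M: "M \<subseteq> {e. w e \<noteq> 0}" "pairwise disjoint_selections M"
       "sum w UNIV \<le> (real CARD('k) - 1) * real (card M)" by blast
  have "sum w UNIV = ?n" using sum_load[of w undefined] by (simp add: load)
  have "\<exists>m. (m, e) \<in> R" if "e \<in> M" for e
  proof (rule ccontr)
    assume "\<not> ?thesis"
    then have "{r. r \<in> R \<and> snd r = e} = {}" by force
    then have "w e = 0" unfolding w_def by (simp only: sum.empty mult_zero_right)
    then show False using M(1) that by blast
  qed
  then obtain col where col: "\<And>e. e \<in> M \<Longrightarrow> (col e, e) \<in> R" by metis
  have inj: "inj_on col M" using col sv unfolding inj_on_def single_valued_def by metis
  define N where "N = (\<lambda>e. \<pi> (col e)) ` M"
  have "card M \<le> (\<Sum>i\<in>N. card {e\<in>M. \<pi> (col e) = i})"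
  proof -
    have "M = (\<Union>i\<in>N. {e\<in>M. \<pi> (col e) = i})" by (auto simp: N_def)
    then show ?thesis using card_UN_le[of N "\<lambda>i. {e\<in>M. \<pi> (col e) = i}"] by (simp add: N_def)
  qed
  also have "\<dots> \<le> (\<Sum>i\<in>N. q)"
  proof (rule sum_mono)
    fix i
    have "inj_on col {e\<in>M. \<pi> (col e) = i}" using inj by (rule inj_on_subset) auto
    moreover have "col ` {e\<in>M. \<pi> (col e) = i} \<subseteq> {m. m < D \<and> \<pi> m = i}" using col RD by auto
    ultimately have "card {e\<in>M. \<pi> (col e) = i} \<le> card {m. m < D \<and> \<pi> m = i}"
      by (rule card_inj_on_le) simp
    then show "card {e\<in>M. \<pi> (col e) = i} \<le> q" using q[of i] by linarith
  qed
  finally have "card M \<le> q * card N" by (simp add: mult.commute)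
  then have "real (card M) \<le> real q * real (card N)" by (metis of_nat_le_iff of_nat_mult)
  then have "(real CARD('k) - 1) * real (card M) \<le> (real CARD('k) - 1) * (real q * real (card N))"
    using k by (intro mult_left_mono) auto
  then have "?n \<le> (real CARD('k) - 1) * (real q * real (card N))"
    using M(3) \<open>sum w UNIV = ?n\<close> by linarith
  moreover have "N \<subseteq> \<pi> ` {..<D}" using col RD by (auto simp: N_def)
  moreover have "jointly_satisfied C x N"
  proof -
    have "\<forall>i\<in>N. \<exists>e. e \<in> M \<and> \<pi> (col e) = i" by (auto simp: N_def)
    then obtain \<sigma> where \<sigma>: "\<And>i. i \<in> N \<Longrightarrow> \<sigma> i \<in> M \<and> \<pi> (col (\<sigma> i)) = i" by metis
    have "x \<in> C i (\<sigma> i)" if "i \<in> N" for i using \<sigma>[OF that] col acc by fastforce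
    moreover have "pairwise (\<lambda>i i'. disjoint_selections (\<sigma> i) (\<sigma> i')) N"
      unfolding pairwise_def using \<sigma> M(2) unfolding pairwise_def by metis
    ultimately show ?thesis unfolding jointly_satisfied_def by blast
  qed
  ultimately show ?thesis using x by blast
qed

lemma card_residue_class_le: "card {m. m < D \<and> Suc (m mod p) = i} \<le> (D - 1) div p + 1"
proof (cases "D = 0")
  case False
  have "inj_on (\<lambda>m. m div p) {m. m < D \<and> Suc (m mod p) = i}"
    by (auto simp: inj_on_def) (metis Suc_inject div_mult_mod_eq)
  moreover have "(\<lambda>m. m div p) ` {m. m < D \<and> Suc (m mod p) = i} \<subseteq> {..(D - 1) div p}"
    by (auto intro!: div_le_mono)
  ultimately have "card {m. m < D \<and> Suc (m mod p) = i} \<le> card {..(D - 1) div p}"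
    by (rule card_inj_on_le) simp
  then show ?thesis by simp
qed simp

theorem theorem1p2:
  fixes C :: "nat \<Rightarrow> ('n::finite, 'k::finite) preferences"
    and p :: nat
  assumes k: "CARD('k) \<ge> 2"
    and p: "1 \<le> p" "p \<le> CARD('k) * (CARD('n) - 1) + 1"
    and preferences: "\<And>i. i \<in> {1..p} \<Longrightarrow> preference_sets (C i)"
    and closed: "\<And>i. i \<in> {1..p} \<Longrightarrow> closed_preferences (C i)"
    and hungry: "\<And>i. i \<in> {1..p} \<Longrightarrow> hungry (C i)"
    and accepts: "\<And>i. i \<in> {1..p} \<Longrightarrow> always_accepts (C i)"
  shows "(\<exists>x\<in>divisions. \<exists>N\<subseteq>{1..p}.
            int (card N) \<ge> \<lceil>real p / (2 * real CARD('k) * (real CARD('k) - 1))\<rceil> \<and>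
            jointly_satisfied C x N) \<and>
         (p dvd CARD('k) * (CARD('n) - 1) + 1 \<longrightarrow>
          (\<exists>x\<in>divisions. \<exists>N\<subseteq>{1..p}.
            int (card N) \<ge> \<lceil>real p / (real CARD('k) * (real CARD('k) - 1))\<rceil> \<and>
            jointly_satisfied C x N))"
proof -
  define D where "D = CARD('k) * (CARD('n) - 1) + 1"
  define q where "q = (D - 1) div p + 1"
  let ?k = "real CARD('k)" and ?n = "real CARD('n)"
  have players: "Suc (m mod p) \<in> {1..p}" for m using p(1) by (simp add: Suc_le_eq)
  have "\<exists>x\<in>divisions. \<exists>N\<subseteq>(\<lambda>m. Suc (m mod p)) ` {..<D}.
      ?n \<le> (?k - 1) * (real q * real (card N)) \<and> jointly_satisfied C x N"
  proof (rule satisfied_players_of_assignment[OF k D_def])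
    show "card {m. m < D \<and> Suc (m mod p) = i} \<le> q" for i
      unfolding q_def by (rule card_residue_class_le)
  qed (use closed[OF players] hungry[OF players] accepts[OF players] in auto)
  then obtain x N where x: "x \<in> divisions" and N: "N \<subseteq> (\<lambda>m. Suc (m mod p)) ` {..<D}"
    "?n \<le> (?k - 1) * (real q * real (card N))" and sat: "jointly_satisfied C x N" by blast
  have sub: "N \<subseteq> {1..p}" using N(1) players by blast
  have k1: "0 < ?k - 1" using k by simp
  have "D \<le> CARD('k) * CARD('n)"
  proof -
    have "CARD('k) * CARD('n) = CARD('k) * (CARD('n) - 1) + CARD('k)"
      by (cases "CARD('n)") auto
    then show ?thesis using k by (simp add: D_def)
  qed
  then have Dn: "real D \<le> ?k * ?n" by (metis of_nat_le_iff of_nat_mult)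
  have bound: "real p / (c * ?k * (?k - 1)) \<le> real (card N)" if c: "0 < c" and pq: "real (p * q) \<le> c * real D" for c
  proof -
    have "real p * ?n \<le> real p * ((?k - 1) * (real q * real (card N)))"
      using N(2) by (intro mult_left_mono) auto
    also have "\<dots> = real (p * q) * ((?k - 1) * real (card N))" by simp
    also have "\<dots> \<le> (c * (?k * ?n)) * ((?k - 1) * real (card N))"
    proof (intro mult_right_mono)
      show "real (p * q) \<le> c * (?k * ?n)" using pq Dn c by (meson order_trans mult_left_mono less_imp_le)
    qed (use k1 in auto)
    finally have "real p * ?n \<le> (real (card N) * (c * ?k * (?k - 1))) * ?n" by (simp add: algebra_simps)
    then have "real p \<le> real (card N) * (c * ?k * (?k - 1))" by (simp add: mult_le_cancel_right)
    then show ?thesis using c k1 k by (simp add: pos_divide_le_eq)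
  qed
  have "p * q = p * ((D - 1) div p) + p" by (simp add: q_def)
  moreover have "p * ((D - 1) div p) \<le> D - 1" "p \<le> D" using p(2) by (simp_all add: D_def)
  ultimately have "p * q \<le> 2 * D" by linarith
  then have "real (p * q) \<le> 2 * real D" by linarith
  then have "real p / (2 * ?k * (?k - 1)) \<le> real (card N)" by (intro bound) auto
  moreover have "real p / (?k * (?k - 1)) \<le> real (card N)" if "p dvd D"
  proof -
    obtain t where t: "D = p * t" using \<open>p dvd D\<close> by blast
    then have "0 < t" by (cases t) (auto simp: D_def)
    have "(D - 1) div p < t" using t p(1) by (simp add: div_less_iff_less_mult mult.commute) (simp add: D_def)
    then have "q \<le> t" by (simp add: q_def)
    then have "p * q \<le> D" using t by simp
    then have "real (p * q) \<le> 1 * real D" by linarith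
    from bound[OF _ this] show ?thesis by simp
  qed
  ultimately show ?thesis using x sub sat unfolding D_def[symmetric]
    by (auto simp: ceiling_le_iff)
qed

end
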